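(* Let $\mathrm{M}$ be the rank $9$ binary matroid on the ground set $\{1,\dots,18\}$ represented over $\mathbb{F}_2$ by the following $9\times 18$ matrix, with column $j$ corresponding to the element $j$: $$\left(\begin{array}{cccccccccccccccccc} 0 & 0 & 1 & 1 & 0 & 0 & 0 & 1 & 0 & 1 & 0 & 1 & 0 & 0 & 0 & 0 & 0 & 0 \\ 0 & 1 & 0 & 1 & 0 & 1 & 0 & 0 & 0 & 0 & 0 & 0 & 1 & 1 & 0 & 0 & 0 & 0 \\ 0 & 0 & 0 & 0 & 0 & 0 & 1 & 1 & 0 & 0 & 0 & 0 & 0 & 1 & 0 & 1 & 0 & 1 \\ 1 & 1 & 1 & 1 & 0 & 0 & 0 & 0 & 0 & 0 & 0 & 0 & 0 & 0 & 0 & 0 & 0 & 0 \\ 0 & 0 & 1 & 1 & 1 & 1 & 0 & 0 & 0 & 0 & 0 & 0 & 0 & 0 & 0 & 0 & 0 & 0 \\ 0 & 0 & 0 & 0 & 0 & 0 & 1 & 1 & 1 & 1 & 0 & 0 & 0 & 0 & 0 & 0 & 0 & 0 \\ 0 & 0 & 0 & 0 & 0 & 0 & 1 & 1 & 0 & 0 & 1 & 1 & 0 & 0 & 0 & 0 & 0 & 0 \\ 0 & 0 & 0 & 0 & 0 & 0 & 0 & 0 & 0 & 0 & 0 & 0 & 1 & 1 & 1 & 1 & 0 & 0 \\ 0 & 0 & 0 & 0 & 0 & 0 & 0 & 0 & 0 & 0 & 0 & 0 & 1 & 1 & 0 & 0 & 1 & 1 \end{array}\right).$$ Then both of the following hold.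 (a) There exist unordered pairs of bases $\{B_1,B_2\}$ and $\{B_1',B_2'\}$ of $\mathrm{M}$ such that the multiset union of $B_1$ and $B_2$ equals the multiset union of $B_1'$ and $B_2'$, but $\{B_1',B_2'\}$ cannot be obtained from $\{B_1,B_2\}$ by any finite sequence of steps, each of which replaces the current unordered pair of bases by a symmetric exchange of it. (b) There exist an integer $s\ge 1$ and sequences of bases $(B_1,\dots,B_s)$ and $(B_1',\dots,B_s')$ of $\mathrm{M}$ such that the multiset union of $B_1,\dots,B_s$ equals the multiset union of $B_1',\dots,B_s'$, but the multiset $\{B_1',\dots,B_s'\}$ cannot be obtained from the multiset $\{B_1,\dots,B_s\}$ by any finite sequence of steps, each of which chooses two members $B_i,B_j$ ($i\neq j$) of the current multiset and a symmetric exchange $(\tilde B_i,\tilde B_j)$ of $(B_i,B_j)$, and replaces $B_i,B_j$ by $\tilde B_i,\tilde B_j$.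
   Context: The matroid represented by a matrix over a field is the matroid on the index set of its columns in which a set of indices is independent if and only if the corresponding columns (as an indexed family) are linearly independent over that field. Given bases $B_1$ and $B_2$ of a matroid, a symmetric exchange of the ordered pair $(B_1,B_2)$ is an ordered pair of bases $(\tilde B_1,\tilde B_2)$ for which there are $x\in B_1$ and $y\in B_2$ such that $\tilde B_1=(B_1\setminus x)\cup y$ and $\tilde B_2=(B_2\setminus y)\cup x$. A symmetric exchange of an unordered pair $\{B_1,B_2\}$ is the unordered pair $\{\tilde B_1,\tilde B_2\}$ underlying a symmetric exchange of $(B_1,B_2)$. Multiset unions count elements with multiplicity. *)

theory Defs
  imports
    "Jordan_Normal_Form.Matrix"
    "HOL-Library.Z2"
    "HOL-Library.Uprod"
    "HOL-Library.Multiset"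
    "HOL-Computational_Algebra.Polynomial"
begin

locale matroid =
  fixes E :: "'a set" and indep :: "'a set \<Rightarrow> bool"
  assumes finite_ground: "finite E"
    and indep_subset_ground: "indep X \<Longrightarrow> X \<subseteq> E"
    and indep_empty: "indep {}"
    and indep_mono: "indep X \<Longrightarrow> Y \<subseteq> X \<Longrightarrow> indep Y"
    and augmentation:
      "indep X \<Longrightarrow> indep Y \<Longrightarrow> card X < card Y \<Longrightarrow> \<exists>y\<in>Y - X. indep (insert y X)"

definition is_basis :: "('a set \<Rightarrow> bool) \<Rightarrow> 'a set \<Rightarrow> bool" where
  "is_basis indep B \<longleftrightarrow> indep B \<and> (\<forall>X. indep X \<longrightarrow> B \<subseteq> X \<longrightarrow> X = B)"

text \<open>Linear independence of the indexed family \<open>(v i)\<close>, \<open>i \<in> I\<close>, of vectors of length \<open>n\<close>;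
  repeated vectors make a family dependent. The index set \<open>I\<close> is meant to be finite.\<close>

definition lin_indpt_family :: "nat \<Rightarrow> ('i \<Rightarrow> 'k :: field vec) \<Rightarrow> 'i set \<Rightarrow> bool" where
  "lin_indpt_family n v I \<longleftrightarrow>
     (\<forall>c. finsum_vec TYPE('k) n (\<lambda>i. c i \<cdot>\<^sub>v v i) I = 0\<^sub>v n \<longrightarrow> (\<forall>i\<in>I. c i = 0))"

text \<open>The ground set is \<open>{1..dim_col A}\<close>, whereas matrix columns are counted from \<open>0\<close>.\<close>

definition matrix_indep :: "'k :: field mat \<Rightarrow> nat set \<Rightarrow> bool" where
  "matrix_indep A S \<longleftrightarrow>
     S \<subseteq> {1..dim_col A} \<and> lin_indpt_family (dim_row A) (\<lambda>j. col A (j - 1)) S"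

definition symmetric_exchange ::
  "('a set \<Rightarrow> bool) \<Rightarrow> 'a set \<times> 'a set \<Rightarrow> 'a set \<times> 'a set \<Rightarrow> bool" where
  "symmetric_exchange indep = (\<lambda>(B1, B2) (C1, C2).
     is_basis indep B1 \<and> is_basis indep B2 \<and> is_basis indep C1 \<and> is_basis indep C2 \<and>
     (\<exists>x\<in>B1. \<exists>y\<in>B2. C1 = (B1 - {x}) \<union> {y} \<and> C2 = (B2 - {y}) \<union> {x}))"

inductive pair_exchange :: "('a set \<Rightarrow> bool) \<Rightarrow> 'a set uprod \<Rightarrow> 'a set uprod \<Rightarrow> bool"
  for indep :: "'a set \<Rightarrow> bool" where
  "symmetric_exchange indep (B1, B2) (C1, C2) \<Longrightarrow>
     pair_exchange indep (Upair B1 B2) (Upair C1 C2)"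

inductive multiset_exchange ::
  "('a set \<Rightarrow> bool) \<Rightarrow> 'a set multiset \<Rightarrow> 'a set multiset \<Rightarrow> bool"
  for indep :: "'a set \<Rightarrow> bool" where
  "symmetric_exchange indep (B1, B2) (C1, C2) \<Longrightarrow>
     multiset_exchange indep (N + {#B1, B2#}) (N + {#C1, C2#})"

definition matrix_M :: "bit mat" where
  "matrix_M = mat_of_rows_list 18
    [[0,0,1,1,0,0,0,1,0,1,0,1,0,0,0,0,0,0],
     [0,1,0,1,0,1,0,0,0,0,0,0,1,1,0,0,0,0],
     [0,0,0,0,0,0,1,1,0,0,0,0,0,1,0,1,0,1],
     [1,1,1,1,0,0,0,0,0,0,0,0,0,0,0,0,0,0],
     [0,0,1,1,1,1,0,0,0,0,0,0,0,0,0,0,0,0],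
     [0,0,0,0,0,0,1,1,1,1,0,0,0,0,0,0,0,0],
     [0,0,0,0,0,0,1,1,0,0,1,1,0,0,0,0,0,0],
     [0,0,0,0,0,0,0,0,0,0,0,0,1,1,1,1,0,0],
     [0,0,0,0,0,0,0,0,0,0,0,0,1,1,0,0,1,1]]"

abbreviation indep_M :: "nat set \<Rightarrow> bool" where
  "indep_M \<equiv> matrix_indep matrix_M"

lemma lin_indpt_family_iff:
  fixes v :: "'i \<Rightarrow> 'k :: field vec"
  assumes "finite I" and v: "\<And>i. i \<in> I \<Longrightarrow> dim_vec (v i) = n"
  shows "lin_indpt_family n v I \<longleftrightarrow>
    (\<forall>c. (\<forall>r<n. (\<Sum>i\<in>I. c i * v i $ r) = 0) \<longrightarrow> (\<forall>i\<in>I. c i = 0))"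
proof -
  have eq: "finsum_vec TYPE('k) n (\<lambda>i. c i \<cdot>\<^sub>v v i) I = 0\<^sub>v n \<longleftrightarrow>
      (\<forall>r<n. (\<Sum>i\<in>I. c i * v i $ r) = 0)" for c
  proof -
    let ?s = "finsum_vec TYPE('k) n (\<lambda>i. c i \<cdot>\<^sub>v v i) I"
    have car: "(\<lambda>i. c i \<cdot>\<^sub>v v i) \<in> I \<rightarrow> carrier_vec n"
      by (rule Pi_I, rule carrier_vecI) (simp only: index_smult_vec v)
    have dim: "dim_vec ?s = n"
      by (rule carrier_vecD[OF finsum_vec_closed[OF car]])
    have entry: "?s $ r = (\<Sum>i\<in>I. c i * v i $ r)" if r: "r < n" for r
      unfolding index_finsum_vec[OF assms(1) r car]
      by (rule sum.cong[OF refl], rule index_smult_vec) (simp only: v r)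
    show ?thesis
    proof
      assume z: "?s = 0\<^sub>v n"
      show "\<forall>r<n. (\<Sum>i\<in>I. c i * v i $ r) = 0"
      proof (intro allI impI)
        fix r assume r: "r < n"
        show "(\<Sum>i\<in>I. c i * v i $ r) = 0"
          unfolding entry[OF r, symmetric] z by (rule index_zero_vec(1)[OF r])
      qed
    next
      assume z: "\<forall>r<n. (\<Sum>i\<in>I. c i * v i $ r) = 0"
      show "?s = 0\<^sub>v n"
      proof (rule eq_vecI)
        fix r assume "r < dim_vec (0\<^sub>v n :: 'k vec)"
        then have r: "r < n" by (simp only: index_zero_vec)
        show "?s $ r = 0\<^sub>v n $ r"
          unfolding entry[OF r] index_zero_vec(1)[OF r] using z r by blast
      qed (simp only: dim index_zero_vec)
    qed
  qed
  show ?thesis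
    unfolding lin_indpt_family_def eq ..
qed

text \<open>The type of polynomials serves as a vector space containing all the vectors at once.\<close>

definition poly_of_vec' :: "'k :: field vec \<Rightarrow> 'k poly" where
  "poly_of_vec' u = (\<Sum>r<dim_vec u. monom (u $ r) r)"

lemma vector_space_smult: "vector_space (smult :: 'k :: field \<Rightarrow> _)"
  by (simp add: vector_space_def smult_add_right smult_add_left)

lemma coeff_poly_of_vec': "coeff (poly_of_vec' u) r = (if r < dim_vec u then u $ r else 0)"
  unfolding poly_of_vec'_def coeff_sum coeff_monom by (subst sum.delta) simp_all

lemma lin_indpt_family_iff_independent:
  fixes v :: "'i \<Rightarrow> 'k :: field vec"
  assumes fin: "finite I" and v: "\<And>i. i \<in> I \<Longrightarrow> dim_vec (v i) = n"
  defines "p \<equiv> \<lambda>i. poly_of_vec' (v i)"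
  shows "lin_indpt_family n v I \<longleftrightarrow>
    inj_on p I \<and> \<not> module.dependent (smult :: 'k \<Rightarrow> _) (p ` I)"
proof -
  interpret vs: vector_space "smult :: 'k \<Rightarrow> _" by (rule vector_space_smult)
  have eq: "(\<Sum>i\<in>I. smult (c i) (p i)) = 0 \<longleftrightarrow> (\<forall>r<n. (\<Sum>i\<in>I. c i * v i $ r) = 0)" for c
  proof -
    have "coeff (\<Sum>i\<in>I. smult (c i) (p i)) r =
        (if r < n then \<Sum>i\<in>I. c i * v i $ r else 0)" for r
    proof -
      have "coeff (\<Sum>i\<in>I. smult (c i) (p i)) r = (\<Sum>i\<in>I. c i * coeff (p i) r)"
        by (simp only: coeff_sum coeff_smult)
      also have "\<dots> = (\<Sum>i\<in>I. if r < n then c i * v i $ r else 0)"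
      proof (rule sum.cong[OF refl])
        fix i assume "i \<in> I"
        then have "dim_vec (v i) = n" by (rule v)
        then show "c i * coeff (p i) r = (if r < n then c i * v i $ r else 0)"
          by (simp add: p_def coeff_poly_of_vec')
      qed
      finally show ?thesis by simp
    qed
    then show ?thesis
      unfolding poly_eq_iff by (simp only: coeff_0) (meson)
  qed
  have iff: "lin_indpt_family n v I \<longleftrightarrow>
      (\<forall>c. (\<Sum>i\<in>I. smult (c i) (p i)) = 0 \<longrightarrow> (\<forall>i\<in>I. c i = 0))"
    unfolding eq by (rule lin_indpt_family_iff[OF fin v])
  show ?thesis
  proof
    assume L: "lin_indpt_family n v I"
    have inj: "inj_on p I"
    proof (rule inj_onI, rule ccontr)
      fix i j assume ij: "i \<in> I" "j \<in> I" "p i = p j" "i \<noteq> j"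
      let ?c = "\<lambda>k. if k = i then 1 else if k = j then -1 else (0::'k)"
      have "(\<Sum>k\<in>I. smult (?c k) (p k)) = (\<Sum>k\<in>{i,j}. smult (?c k) (p k))"
        using ij fin by (intro sum.mono_neutral_right) auto
      also have "\<dots> = 0" using ij by simp
      finally have "?c i = 0" using L[unfolded iff, rule_format, of ?c i] ij by blast
      then show False by simp
    qed
    have "\<not> vs.dependent (p ` I)"
    proof
      assume "vs.dependent (p ` I)"
      then obtain u w where u: "w \<in> p ` I" "u w \<noteq> 0" "(\<Sum>w\<in>p ` I. smult (u w) w) = 0"
        using vs.dependent_finite[of "p ` I"] fin by auto
      have "(\<Sum>i\<in>I. smult (u (p i)) (p i)) = 0"
        using u(3) by (simp add: sum.reindex[OF inj])
      then show False using L[unfolded iff, rule_format, of "\<lambda>i. u (p i)"] u by blast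
    qed
    with inj show "inj_on p I \<and> \<not> vs.dependent (p ` I)" by blast
  next
    assume R: "inj_on p I \<and> \<not> vs.dependent (p ` I)"
    then have inj: "inj_on p I" by blast
    show "lin_indpt_family n v I"
      unfolding iff
    proof (intro allI impI ballI)
      fix c i assume s: "(\<Sum>i\<in>I. smult (c i) (p i)) = 0" and i: "i \<in> I"
      let ?u = "\<lambda>w. c (the_inv_into I p w)"
      have "(\<Sum>w\<in>p ` I. smult (?u w) w) = (\<Sum>i\<in>I. smult (c i) (p i))"
        by (simp add: sum.reindex[OF inj] the_inv_into_f_f[OF inj])
      from this s have z: "(\<Sum>w\<in>p ` I. smult (?u w) w) = 0" by (rule trans)
      have "\<not> (\<exists>u. (\<exists>w\<in>p ` I. u w \<noteq> 0) \<and> (\<Sum>w\<in>p ` I. smult (u w) w) = 0)"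
        using R vs.dependent_finite[OF finite_imageI[OF fin, of p]] by blast
      then have "\<not> ((\<exists>w\<in>p ` I. ?u w \<noteq> 0) \<and> (\<Sum>w\<in>p ` I. smult (?u w) w) = 0)"
        by (rule contrapos_nn) (rule exI)
      then have "?u (p i) = 0" using z i by blast
      then show "c i = 0" using i by (simp add: the_inv_into_f_f[OF inj])
    qed
  qed
qed

lemma matrix_indep_iff:
  fixes A :: "'k :: field mat"
  defines "p \<equiv> \<lambda>j. poly_of_vec' (col A (j - 1))"
  shows "matrix_indep A S \<longleftrightarrow> S \<subseteq> {1..dim_col A} \<and>
    inj_on p S \<and> \<not> module.dependent (smult :: 'k \<Rightarrow> _) (p ` S)"
proof (cases "S \<subseteq> {1..dim_col A}")
  case True
  then have "finite S" using finite_subset by blast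
  then show ?thesis
    using lin_indpt_family_iff_independent[of S "\<lambda>j. col A (j - 1)" "dim_row A"] True
    unfolding matrix_indep_def p_def by simp
qed (simp add: matrix_indep_def)

theorem matroid_matrix_indep:
  fixes A :: "'k :: field mat"
  shows "matroid {1..dim_col A} (matrix_indep A)"
proof -
  interpret vs: vector_space "smult :: 'k \<Rightarrow> _" by (rule vector_space_smult)
  define p where "p = (\<lambda>j. poly_of_vec' (col A (j - 1)))"
  note iff = matrix_indep_iff[of A, folded p_def]
  show ?thesis
  proof
    fix X Y assume "matrix_indep A X" "Y \<subseteq> X"
    then show "matrix_indep A Y"
      unfolding iff by (meson image_mono inj_on_subset subset_trans vs.dependent_mono)
  next
    fix X Y assume X: "matrix_indep A X" and Y: "matrix_indep A Y" and less: "card X < card Y"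
    show "\<exists>y\<in>Y - X. matrix_indep A (insert y X)"
    proof (rule ccontr)
      assume neg: "\<not> ?thesis"
      have finX: "finite X" using X iff finite_subset by blast
      have "p y \<in> vs.span (p ` X)" if y: "y \<in> Y" for y
      proof (cases "y \<in> X")
        case True then show ?thesis by (simp add: vs.span_base)
      next
        case False
        show ?thesis
        proof (rule ccontr)
          assume n: "p y \<notin> vs.span (p ` X)"
          then have "p y \<notin> p ` X" using vs.span_base by blast
          then have "matrix_indep A (insert y X)"
            using X Y y n False vs.independent_insertI[OF n] unfolding iff by auto
          then show False using neg False y by blast
        qed
      qed
      then have "card (p ` Y) \<le> card (p ` X)"
        using vs.independent_span_bound[of "p ` X" "p ` Y"] finX Y unfolding iff by auto
      then show False using X Y less unfolding iff by (simp add: card_image)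
    qed
  qed (auto simp: iff vs.independent_empty)
qed

lemma card_matrix_indep_le:
  fixes A :: "'k :: field mat"
  assumes "matrix_indep A S"
  shows "card S \<le> dim_row A"
proof -
  interpret vs: vector_space "smult :: 'k \<Rightarrow> _" by (rule vector_space_smult)
  define p where "p = (\<lambda>j. poly_of_vec' (col A (j - 1)))"
  define T :: "'k poly set" where "T = monom 1 ` {..<dim_row A}"
  have S: "inj_on p S" "\<not> vs.dependent (p ` S)"
    using assms unfolding matrix_indep_iff p_def by auto
  have "p j \<in> vs.span T" for j
  proof -
    have "p j = (\<Sum>r<dim_row A. smult (col A (j - 1) $ r) (monom 1 r))"
      by (simp add: p_def poly_of_vec'_def smult_monom)
    also have "\<dots> \<in> vs.span T"
      by (intro vs.span_sum vs.span_scale vs.span_base) (auto simp: T_def)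
    finally show ?thesis .
  qed
  then have "card (p ` S) \<le> card T"
    using vs.independent_span_bound[of T "p ` S"] S by (auto simp: T_def)
  also have "\<dots> \<le> dim_row A"
    unfolding T_def using card_image_le[of "{..<dim_row A}" "monom (1 :: 'k)"] by simp
  finally show ?thesis using S by (simp add: card_image)
qed

lemma dim_matrix_M [simp]: "dim_row matrix_M = 9" "dim_col matrix_M = 18"
  by (simp_all add: matrix_M_def mat_of_rows_list_def)

lemma indep_M_example: "indep_M {3,5,7,9,11,12,14,16,17}" (is "indep_M ?S")
proof -
  have "lin_indpt_family 9 (\<lambda>j. col matrix_M (j - 1)) ?S"
  proof (subst lin_indpt_family_iff, simp, simp, intro allI impI)
    fix c :: "nat \<Rightarrow> bit"
    assume *: "\<forall>r<9. (\<Sum>j\<in>?S. c j * col matrix_M (j - 1) $ r) = 0"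
    have sum9: "(\<Sum>j\<in>?S. f j) = f 3 + (f 5 + (f 7 + (f 9 + (f 11 + (f 12 + (f 14 + (f 16 + f 17)))))))"
      for f :: "nat \<Rightarrow> bit"
      by (simp del: sum_of_bool_mult_eq sum_mult_of_bool_eq)
    have row: "c 3 * matrix_M $$ (r, 2) + (c 5 * matrix_M $$ (r, 4) + (c 7 * matrix_M $$ (r, 6) +
        (c 9 * matrix_M $$ (r, 8) + (c 11 * matrix_M $$ (r, 10) + (c 12 * matrix_M $$ (r, 11) +
        (c 14 * matrix_M $$ (r, 13) + (c 16 * matrix_M $$ (r, 15) + c 17 * matrix_M $$ (r, 16)))))))) = 0"
      if "r < 9" for r
      using *[rule_format, OF that, unfolded sum9] that by (simp only: index_col dim_matrix_M) simp
    note M = matrix_M_def mat_of_rows_list_def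
    have "c 14 = 0" using row[of 1] by (simp add: M)
    moreover have "c 3 = 0" using row[of 3] by (simp add: M)
    moreover have "c 3 + c 12 = 0" using row[of 0] by (simp add: M)
    moreover have "c 7 + (c 14 + c 16) = 0" using row[of 2] by (simp add: M)
    moreover have "c 3 + c 5 = 0" using row[of 4] by (simp add: M)
    moreover have "c 7 + c 9 = 0" using row[of 5] by (simp add: M)
    moreover have "c 7 + (c 11 + c 12) = 0" using row[of 6] by (simp add: M)
    moreover have "c 14 + c 16 = 0" using row[of 7] by (simp add: M)
    moreover have "c 14 + c 17 = 0" using row[of 8] by (simp add: M)
    ultimately show "\<forall>j\<in>?S. c j = 0" by simp
  qed
  then show ?thesis
    by (simp add: matrix_indep_def)
qed

theorem matroid_M: "matroid {1..18} indep_M"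
  using matroid_matrix_indep[of matrix_M] by simp

theorem rank_M: "is_basis indep_M B \<Longrightarrow> card B = 9"
proof (rule ccontr)
  assume B: "is_basis indep_M B" and "card B \<noteq> 9"
  moreover have "card B \<le> 9"
    using B card_matrix_indep_le[of matrix_M B] by (simp add: is_basis_def)
  ultimately have "card B < card {3,5,7,9,11,12,14,16,17::nat}" by simp
  moreover have "indep_M B" using B by (simp add: is_basis_def)
  ultimately obtain y where "y \<notin> B" "indep_M (insert y B)"
    using matroid.augmentation[OF matroid_M _ indep_M_example, of B] by blast
  with B show False unfolding is_basis_def by blast
qed

end

theory Submission
  imports Defs
begin

text \<open>
  The ground set splits into nine pairs \<open>{2p+1, 2p+2}\<close> and the pairs into three consecutive groups
  of three. The two columns of a pair in a group add up to a unit vector that depends only on the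
  group, and a transversal of the three pairs of a group with odd sum of labels adds up to the unit
  vector of the cyclically next group. So such a transversal together with a pair of the next group
  is dependent. For complementary bases \<open>S\<close> and \<open>S'\<close> call a group mixed if \<open>S\<close> contains one of its
  pairs and \<open>S'\<close> another one. If a group is mixed, then neither \<open>S\<close> nor \<open>S'\<close> contains an odd
  transversal of the preceding group; as the complement of an odd transversal in its group is
  another transversal of the opposite parity, this forces the preceding group to be mixed as well.
  Hence either all groups are mixed or none is. A symmetric exchange leaves at least one of the
  three groups untouched, so it cannot lead from the first kind of pairs to the second.
\<close>

section \<open>Independence and bases in terms of matrix entries\<close>

lemma matrix_M_entry:
  assumes "r < 9" "j < 18"
  shows "matrix_M $$ (r, j) =
    [[0,0,1,1,0,0,0,1,0,1,0,1,0,0,0,0,0,0],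
     [0,1,0,1,0,1,0,0,0,0,0,0,1,1,0,0,0,0],
     [0,0,0,0,0,0,1,1,0,0,0,0,0,1,0,1,0,1],
     [1,1,1,1,0,0,0,0,0,0,0,0,0,0,0,0,0,0],
     [0,0,1,1,1,1,0,0,0,0,0,0,0,0,0,0,0,0],
     [0,0,0,0,0,0,1,1,1,1,0,0,0,0,0,0,0,0],
     [0,0,0,0,0,0,1,1,0,0,1,1,0,0,0,0,0,0],
     [0,0,0,0,0,0,0,0,0,0,0,0,1,1,1,1,0,0],
     [0,0,0,0,0,0,0,0,0,0,0,0,1,1,0,0,1,1]] ! r ! j"
    (is "_ = ?rows ! r ! j")
proof -
  have "length ?rows = 9" by simp
  then show ?thesis
    using assms by (simp only: matrix_M_def mat_of_rows_list_def index_mat(1) prod.case)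
qed

text \<open>Summing over a list instead of a set lets \<open>simp\<close> expand the row equations
  for explicit elements. The shift \<open>j - 1\<close> turns an element into its column
  index.\<close>

lemma matrix_M_indep_iff:
  assumes "distinct js" "set js \<subseteq> {1..18}"
  shows "indep_M (set js) \<longleftrightarrow>
    (\<forall>c. (\<forall>r<9. (\<Sum>j\<leftarrow>js. c j * matrix_M $$ (r, j - 1)) = 0) \<longrightarrow> (\<forall>j\<in>set js. c j = 0))"
proof -
  have "(\<Sum>j\<in>set js. c j * col matrix_M (j - 1) $ r) = (\<Sum>j\<leftarrow>js. c j * matrix_M $$ (r, j - 1))"
    if "r < 9" for c :: "nat \<Rightarrow> bit" and r
    unfolding sum.distinct_set_conv_list[OF assms(1)]
  proof (intro arg_cong[of _ _ sum_list] map_cong[OF refl])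
    fix j assume "j \<in> set js"
    then have "j - 1 < 18" using assms(2) by fastforce
    then show "c j * col matrix_M (j - 1) $ r = c j * matrix_M $$ (r, j - 1)"
      using that by (simp only: index_col dim_matrix_M)
  qed
  then show ?thesis
    unfolding matrix_indep_def
    using assms(2) by (simp add: lin_indpt_family_iff)
qed

lemma basis_M_iff: "is_basis indep_M B \<longleftrightarrow> indep_M B \<and> card B = 9"
proof
  assume B: "indep_M B \<and> card B = 9"
  have "X = B" if "indep_M X" "B \<subseteq> X" for X
  proof -
    have "finite X" using that(1) finite_subset by (auto simp: matrix_indep_def)
    moreover have "card X \<le> 9" using card_matrix_indep_le[OF that(1)] by simp
    ultimately show ?thesis using that(2) B card_seteq[of X B] by auto
  qed
  then show "is_basis indep_M B" using B by (simp add: is_basis_def)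
qed (simp add: rank_M, simp add: is_basis_def)

lemma all_less_9: "(\<forall>r<9::nat. P r) \<longleftrightarrow>
  P 0 \<and> P 1 \<and> P 2 \<and> P 3 \<and> P 4 \<and> P 5 \<and> P 6 \<and> P 7 \<and> P 8"
proof -
  have "{..<9} = {0,1,2,3,4,5,6,7,8::nat}"
    by (simp add: lessThan_nat_numeral lessThan_Suc insert_commute)
  moreover have "(\<forall>r<9. P r) \<longleftrightarrow> (\<forall>r\<in>{..<9}. P r)" by blast
  ultimately show ?thesis by (simp only: ball_simps) simp
qed

lemma basis_M_list:
  assumes "distinct js" "set js \<subseteq> {1..18}" "length js = 9"
    and "\<And>c :: nat \<Rightarrow> bit. \<forall>r<9. (\<Sum>j\<leftarrow>js. c j * matrix_M $$ (r, j - 1)) = 0 \<Longrightarrow> \<forall>j\<in>set js. c j = 0"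
  shows "is_basis indep_M (set js)"
  unfolding basis_M_iff matrix_M_indep_iff[OF assms(1,2)] distinct_card[OF assms(1)]
  using assms(3,4) by blast

lemma bit_add_eq_0_iff: "a + b = 0 \<longleftrightarrow> a = (b :: bit)"
  by (cases a; cases b) simp_all

text \<open>Used to present the two values of a bit to \<open>blast\<close> as complementary, once
  the row equations are simplified.\<close>

lemma bit_eq_0_iff: "b = 0 \<longleftrightarrow> b \<noteq> (1 :: bit)"
  by simp

text \<open>The first two sets are complementary in the ground set, and so are the last two.\<close>

lemma bases_M:
  "is_basis indep_M {3,5,7,9,11,12,14,16,17}"
  "is_basis indep_M {1,2,4,6,8,10,13,15,18}"
  "is_basis indep_M {3,4,5,7,9,10,13,14,15}"
  "is_basis indep_M {1,2,6,8,11,12,16,17,18}"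
proof -
  note simps = all_less_9 matrix_M_entry bit_add_eq_0_iff
  show "is_basis indep_M {3,5,7,9,11,12,14,16,17}"
    by (rule basis_M_list[of "[3,5,7,9,11,12,14,16,17]", unfolded list.set])
      (simp_all add: simps, unfold bit_eq_0_iff, blast)
  show "is_basis indep_M {1,2,4,6,8,10,13,15,18}"
    by (rule basis_M_list[of "[1,2,4,6,8,10,13,15,18]", unfolded list.set])
      (simp_all add: simps, unfold bit_eq_0_iff, blast)
  show "is_basis indep_M {3,4,5,7,9,10,13,14,15}"
    by (rule basis_M_list[of "[3,4,5,7,9,10,13,14,15]", unfolded list.set])
      (simp_all add: simps, unfold bit_eq_0_iff, blast)
  show "is_basis indep_M {1,2,6,8,11,12,16,17,18}"
    by (rule basis_M_list[of "[1,2,6,8,11,12,16,17,18]", unfolded list.set])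
      (simp_all add: simps, unfold bit_eq_0_iff, blast)
qed

text \<open>Over the two-element field, columns with zero sum satisfy a nontrivial relation with all
  coefficients 1.\<close>

lemma dependent_M:
  assumes "distinct js" "js \<noteq> []" "set js \<subseteq> B" "is_basis indep_M B"
  shows "\<exists>r<9. (\<Sum>j\<leftarrow>js. matrix_M $$ (r, j - 1)) \<noteq> 0"
proof (rule ccontr)
  assume "\<not> ?thesis"
  then have neg: "\<forall>r<9. (\<Sum>j\<leftarrow>js. matrix_M $$ (r, j - 1)) = 0" by blast
  have indep: "indep_M (set js)"
    using assms(3,4) matroid.indep_mono[OF matroid_M] by (auto simp: is_basis_def)
  then have "set js \<subseteq> {1..18}" by (simp add: matrix_indep_def)
  note matrix_M_indep_iff[OF assms(1) this, THEN iffD1, OF indep,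
      THEN spec, of "\<lambda>_. 1", unfolded mult_1]
  from this neg have "\<forall>j\<in>set js. 1 = (0 :: bit)" by (rule mp)
  with assms(2) show False by simp
qed

section \<open>Pairs, groups and the relations among their columns\<close>

definition pair :: "nat \<Rightarrow> nat set" where
  "pair p = {2 * p + 1, 2 * p + 2}"

text \<open>Pairs and groups are counted from 0, elements from 1: group \<open>g\<close> covers the
  elements \<open>6 * g + 1\<close> to \<open>6 * g + 6\<close>.\<close>

definition group_pairs :: "nat \<Rightarrow> nat set" where
  "group_pairs g = {3 * g, 3 * g + 1, 3 * g + 2}"

text \<open>The list \<open>[1, 0, 2]\<close> gives for each group the row of its unit vector, the
  only row in which the two columns of a pair differ.\<close>

lemma pair_sum:
  assumes "r < 9" "g < 3" "p \<in> group_pairs g"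
  shows "matrix_M $$ (r, 2 * p) + matrix_M $$ (r, 2 * p + 1) = of_bool (r = [1, 0, 2] ! g)"
proof -
  have "\<forall>r<9. matrix_M $$ (r, 2 * p) + matrix_M $$ (r, 2 * p + 1) = of_bool (r = [1, 0, 2] ! g)"
  proof -
    have "g = 0 \<or> g = 1 \<or> g = 2" "p = 3 * g \<or> p = 3 * g + 1 \<or> p = 3 * g + 2"
      using assms(2,3) by (auto simp: group_pairs_def)
    then show ?thesis
      unfolding all_less_9 by (elim disjE) (simp_all add: matrix_M_entry)
  qed
  with assms(1) show ?thesis by blast
qed

text \<open>In any transversal the two lower rows of the group cancel, and the row of the next group
  receives a single 1, from one of the three pairs. The row of the group itself counts the even
  labels; for three labels with odd sum this number is even.\<close>

lemma odd_transversal_sum: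
  assumes "r < 9" "g < 3" "x \<in> pair (3 * g)" "y \<in> pair (3 * g + 1)" "z \<in> pair (3 * g + 2)"
    and odd: "odd (x + y + z)"
  shows "matrix_M $$ (r, x - 1) + matrix_M $$ (r, y - 1) + matrix_M $$ (r, z - 1) =
    of_bool (r = [1, 0, 2] ! ((g + 1) mod 3))"
proof -
  have "\<forall>r<9. matrix_M $$ (r, x - 1) + matrix_M $$ (r, y - 1) + matrix_M $$ (r, z - 1) =
    of_bool (r = [1, 0, 2] ! ((g + 1) mod 3))"
  proof -
    have "g = 0 \<or> g = 1 \<or> g = 2" "x = 6 * g + 1 \<or> x = 6 * g + 2"
      "y = 6 * g + 3 \<or> y = 6 * g + 4" "z = 6 * g + 5 \<or> z = 6 * g + 6"
      using assms(2-5) by (auto simp: pair_def)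
    then show ?thesis
      using odd unfolding all_less_9 by (elim disjE) (simp_all add: matrix_M_entry)
  qed
  with assms(1) show ?thesis by blast
qed

lemma transversal_pair_dependent:
  assumes S: "is_basis indep_M S" and g: "g < 3"
    and xyz: "x \<in> pair (3 * g)" "y \<in> pair (3 * g + 1)" "z \<in> pair (3 * g + 2)" "odd (x + y + z)"
    and p: "p \<in> group_pairs ((g + 1) mod 3)"
    and sub: "{x, y, z} \<subseteq> S"
  shows "\<not> pair p \<subseteq> S"
proof
  assume pair: "pair p \<subseteq> S"
  let ?js = "[x, y, z, 2 * p + 1, 2 * p + 2]"
  \<comment> \<open>The pair lies in another group than the transversal, so the five elements are
    distinct.\<close>
  have "p < 3 * g \<or> 3 * g + 3 \<le> p"
  proof -
    have "g = 0 \<or> g = 1 \<or> g = 2" using g by auto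
    then show ?thesis using p by (elim disjE) (auto simp: group_pairs_def)
  qed
  moreover have "6 * g < x \<and> x \<le> 6 * g + 2 \<and> 6 * g + 2 < y \<and> y \<le> 6 * g + 4 \<and>
      6 * g + 4 < z \<and> z \<le> 6 * g + 6"
    using xyz(1-3) by (auto simp: pair_def)
  ultimately have "distinct ?js" by auto
  moreover have "set ?js \<subseteq> S" using sub pair by (simp add: pair_def)
  ultimately obtain r where r: "r < 9" and "(\<Sum>j\<leftarrow>?js. matrix_M $$ (r, j - 1)) \<noteq> 0"
    using dependent_M[of ?js S] S by blast
  moreover have "(\<Sum>j\<leftarrow>?js. matrix_M $$ (r, j - 1)) =
      (matrix_M $$ (r, x - 1) + matrix_M $$ (r, y - 1) + matrix_M $$ (r, z - 1)) +
      (matrix_M $$ (r, 2 * p) + matrix_M $$ (r, 2 * p + 1))"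
  proof -
    have "2 * p + 1 - 1 = 2 * p" "2 * p + 2 - 1 = 2 * p + 1" by simp_all
    then show ?thesis
      by (simp only: list.map sum_list.Cons sum_list.Nil add.assoc add_0_right)
  qed
  moreover have "\<dots> = 0"
  proof -
    have "(g + 1) mod 3 < 3" by simp
    then show ?thesis
      by (simp only: odd_transversal_sum[OF r g xyz] pair_sum[OF r _ p]) simp
  qed
  ultimately show False by simp
qed

section \<open>Mixed groups and their behaviour under one exchange\<close>

definition mixed :: "nat \<Rightarrow> nat set \<Rightarrow> bool" where
  "mixed g S \<longleftrightarrow> (\<exists>p\<in>group_pairs g. pair p \<subseteq> S) \<and> (\<exists>p\<in>group_pairs g. pair p \<inter> S = {})"

lemma pair_subset_ground: "g < 3 \<Longrightarrow> p \<in> group_pairs g \<Longrightarrow> pair p \<subseteq> {1..18}"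
  by (auto simp: pair_def group_pairs_def)

text \<open>A pair misses \<open>S\<close> exactly if it lies in the complement, so either member of
  an unordered pair of complementary bases may serve as \<open>S\<close>.\<close>

lemma mixed_compl: "g < 3 \<Longrightarrow> mixed g ({1..18} - S) \<longleftrightarrow> mixed g S"
  using pair_subset_ground[of g] unfolding mixed_def by blast

lemma mixed_pred:
  assumes S: "is_basis indep_M S" "is_basis indep_M ({1..18} - S)" and g: "g < 3"
    and mixed: "mixed ((g + 1) mod 3) S"
  shows "mixed g S"
proof -
  let ?E = "{1..18} :: nat set"
  have no_transversal: "\<not> (x \<in> S \<and> y \<in> S \<and> z \<in> S) \<and> (x \<in> S \<or> y \<in> S \<or> z \<in> S)"
    if "x \<in> pair (3 * g)" "y \<in> pair (3 * g + 1)" "z \<in> pair (3 * g + 2)" "odd (x + y + z)" for x y z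
  proof -
    obtain p q where p: "p \<in> group_pairs ((g + 1) mod 3)" "pair p \<subseteq> S"
      and q: "q \<in> group_pairs ((g + 1) mod 3)" "pair q \<inter> S = {}"
      using mixed unfolding mixed_def by blast
    have "pair q \<subseteq> ?E - S"
      using q pair_subset_ground[of "(g + 1) mod 3" q] by auto
    moreover have "{x, y, z} \<subseteq> ?E"
      using that(1-3) g by (auto simp: pair_def)
    ultimately have "\<not> {x, y, z} \<subseteq> S" "\<not> {x, y, z} \<subseteq> ?E - S"
      using transversal_pair_dependent[OF S(1) g that p(1)]
        transversal_pair_dependent[OF S(2) g that q(1)] p(2) by satx+
    with \<open>{x, y, z} \<subseteq> ?E\<close> show ?thesis by simp
  qed
  let ?a = "6 * g + 1" and ?b = "6 * g + 2" and ?c = "6 * g + 3"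
    and ?d = "6 * g + 4" and ?e = "6 * g + 5" and ?f = "6 * g + 6"
  have pairs: "pair (3 * g) = {?a, ?b}" "pair (3 * g + 1) = {?c, ?d}" "pair (3 * g + 2) = {?e, ?f}"
    by (auto simp: pair_def)
  \<comment> \<open>The even labels are \<open>?b\<close>, \<open>?d\<close>, \<open>?f\<close>; the
    four odd transversals are those with none or two of them.\<close>
  have "\<not> (?a \<in> S \<and> ?c \<in> S \<and> ?e \<in> S) \<and> (?a \<in> S \<or> ?c \<in> S \<or> ?e \<in> S)"
    by (rule no_transversal, unfold pairs) simp_all
  moreover have "\<not> (?a \<in> S \<and> ?d \<in> S \<and> ?f \<in> S) \<and> (?a \<in> S \<or> ?d \<in> S \<or> ?f \<in> S)"
    by (rule no_transversal, unfold pairs) simp_all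
  moreover have "\<not> (?b \<in> S \<and> ?c \<in> S \<and> ?f \<in> S) \<and> (?b \<in> S \<or> ?c \<in> S \<or> ?f \<in> S)"
    by (rule no_transversal, unfold pairs) simp_all
  moreover have "\<not> (?b \<in> S \<and> ?d \<in> S \<and> ?e \<in> S) \<and> (?b \<in> S \<or> ?d \<in> S \<or> ?e \<in> S)"
    by (rule no_transversal, unfold pairs) simp_all
  moreover have "mixed g S \<longleftrightarrow>
      (?a \<in> S \<and> ?b \<in> S \<or> ?c \<in> S \<and> ?d \<in> S \<or> ?e \<in> S \<and> ?f \<in> S) \<and>
      (?a \<notin> S \<and> ?b \<notin> S \<or> ?c \<notin> S \<and> ?d \<notin> S \<or> ?e \<notin> S \<and> ?f \<notin> S)"
    unfolding mixed_def group_pairs_def bex_simps pairs by blast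
  \<comment> \<open>If one side contains no pair of the group, the other meets all three pairs. Were
    it to contain a whole pair, it would contain transversals of both parities; otherwise the two
    sides are transversals of opposite parity. Either way an odd one arises.\<close>
  ultimately show ?thesis by argo
qed

text \<open>Steps from a group to its predecessor go round the whole cycle of three groups.\<close>

lemma mixed_all:
  assumes S: "is_basis indep_M S" "is_basis indep_M ({1..18} - S)" "g < 3" "mixed g S" "h < 3"
  shows "mixed h S"
proof -
  have mod: "(0 + 1) mod 3 = (1 :: nat)" "(1 + 1) mod 3 = (2 :: nat)" "(2 + 1) mod 3 = (0 :: nat)"
    by simp_all
  have "mixed 1 S \<Longrightarrow> mixed 0 S" "mixed 2 S \<Longrightarrow> mixed 1 S" "mixed 0 S \<Longrightarrow> mixed 2 S"
    using mixed_pred[OF S(1,2), of 0] mixed_pred[OF S(1,2), of 1] mixed_pred[OF S(1,2), of 2]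
    unfolding mod by simp_all
  moreover have "g = 0 \<or> g = 1 \<or> g = 2" "h = 0 \<or> h = 1 \<or> h = 2" using S(3,5) by auto
  ultimately show ?thesis using S(4) by auto
qed

lemma exchange_mixed:
  assumes ex: "symmetric_exchange indep_M (S, {1..18} - S) (C1, C2)" and mixed: "mixed 0 S"
  shows "C2 = {1..18} - C1 \<and> mixed 0 C1"
proof -
  obtain x y where xy: "x \<in> S" "y \<in> {1..18} - S" "C1 = (S - {x}) \<union> {y}"
      "C2 = ({1..18} - S - {y}) \<union> {x}"
    and bases: "is_basis indep_M S" "is_basis indep_M ({1..18} - S)"
      "is_basis indep_M C1" "is_basis indep_M C2"
    using ex unfolding symmetric_exchange_def by auto
  have "S \<subseteq> {1..18}" using bases(1) by (simp add: is_basis_def matrix_indep_def)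
  then have C2: "C2 = {1..18} - C1" using xy by blast
  have "\<exists>g<3. g \<noteq> a \<and> g \<noteq> b" for a b :: nat
    by presburger
  \<comment> \<open>The quotients are the groups of \<open>x\<close> and \<open>y\<close>, so group
    \<open>g\<close> is untouched and stays mixed; \<open>mixed_all\<close> for the new bases then
    returns to group 0.\<close>
  then obtain g where g: "g < 3" "g \<noteq> (x - 1) div 6" "g \<noteq> (y - 1) div 6" by blast
  have "x \<notin> pair p \<and> y \<notin> pair p" if "p \<in> group_pairs g" for p
    using that g(2,3) by (auto simp: pair_def group_pairs_def)
  moreover have "mixed g S" using mixed_all[OF bases(1,2) _ mixed g(1)] by simp
  ultimately have "mixed g C1" unfolding mixed_def xy(3) by blast
  then show ?thesis using mixed_all[of C1 g 0] bases g(1) C2 by simp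
qed

section \<open>Sequences of exchanges\<close>

lemma pair_exchange_invariant:
  assumes "(pair_exchange indep_M)\<^sup>*\<^sup>* (Upair S ({1..18} - S)) U" "mixed 0 S"
  shows "\<exists>T. U = Upair T ({1..18} - T) \<and> mixed 0 T"
  using assms
proof (induction rule: rtranclp_induct)
  case (step U V)
  then obtain T where T: "U = Upair T ({1..18} - T)" "mixed 0 T" by blast
  from step.hyps(2) show ?case
  proof cases
    case (1 B1 B2 C1 C2)
    \<comment> \<open>Within the ground set complementation is an involution, which covers the case
      that \<open>B1\<close> is the complement of \<open>T\<close>.\<close>
    have "B1 \<subseteq> {1..18}" "B2 \<subseteq> {1..18}"
      using 1(3) by (auto simp: symmetric_exchange_def is_basis_def matrix_indep_def)
    then have "B2 = {1..18} - B1 \<and> mixed 0 B1"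
      using 1(1) T mixed_compl[of 0 T] by auto
    then show ?thesis using exchange_mixed[of B1 C1 C2] 1 by blast
  qed
qed blast

lemma multiset_exchange_invariant:
  assumes "(multiset_exchange indep_M)\<^sup>*\<^sup>* {#S, {1..18} - S#} N" "mixed 0 S"
  shows "\<exists>T. N = {#T, {1..18} - T#} \<and> mixed 0 T"
  using assms
proof (induction rule: rtranclp_induct)
  case (step M N)
  then obtain T where T: "M = {#T, {1..18} - T#}" "mixed 0 T" by blast
  from step.hyps(2) show ?case
  proof cases
    case (1 B1 B2 C1 C2 K)
    \<comment> \<open>With only two members, the exchange involves the whole multiset.\<close>
    have "size (K + {#B1, B2#}) = size {#T, {1..18} - T#}" using 1(1) T(1) by argo
    then have K: "K = {#}" by simp
    have "B1 \<subseteq> {1..18}" "B2 \<subseteq> {1..18}"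
      using 1(3) by (auto simp: symmetric_exchange_def is_basis_def matrix_indep_def)
    moreover have "{#B1, B2#} = {#T, {1..18} - T#}" using 1(1) T(1) K by simp
    ultimately have "B2 = {1..18} - B1 \<and> mixed 0 B1"
      using T(2) mixed_compl[of 0 T] by (auto simp: add_eq_conv_ex)
    then show ?thesis using exchange_mixed[of B1 C1 C2] 1 K by auto
  qed
qed blast

theorem theorem1p5:
  shows
    "(\<exists>B1 B2 B1' B2'.
        is_basis indep_M B1 \<and> is_basis indep_M B2 \<and>
        is_basis indep_M B1' \<and> is_basis indep_M B2' \<and>
        mset_set B1 + mset_set B2 = mset_set B1' + mset_set B2' \<and>
        \<not> (pair_exchange indep_M)\<^sup>*\<^sup>* (Upair B1 B2) (Upair B1' B2'))
     \<and>
     (\<exists>s\<ge>1. \<exists>Bs Bs'.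
        length Bs = s \<and> length Bs' = s \<and>
        (\<forall>B\<in>set Bs. is_basis indep_M B) \<and> (\<forall>B\<in>set Bs'. is_basis indep_M B) \<and>
        (\<Sum>B\<leftarrow>Bs. mset_set B) = (\<Sum>B\<leftarrow>Bs'. mset_set B) \<and>
        \<not> (multiset_exchange indep_M)\<^sup>*\<^sup>* (mset Bs) (mset Bs'))"
proof -
  \<comment> \<open>In group 0, \<open>B\<close> contains the pair of 3 and 4 and misses that of 1
    and 2, whereas \<open>C\<close> contains no pair. The same two pairs of bases serve for both
    claims, with \<open>s\<close> equal to 2 in the second.\<close>
  define B where "B = {3,4,5,7,9,10,13,14,15::nat}"
  define C where "C = {3,5,7,9,11,12,14,16,17::nat}"
  have E: "{1..18} = {1,2,3,4,5,6,7,8,9,10,11,12,13,14,15,16,17,18::nat}"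
    by (auto simp: numeral_eq_Suc le_Suc_eq)
  have compl: "{1..18} - B = {1,2,6,8,11,12,16,17,18}" "{1..18} - C = {1,2,4,6,8,10,13,15,18}"
    unfolding E B_def C_def by auto
  note bases = bases_M[folded compl B_def C_def]
  have union: "mset_set B + mset_set ({1..18} - B) = mset_set C + mset_set ({1..18} - C)"
    unfolding compl by (simp add: B_def C_def)
  have B: "mixed 0 B" and C: "\<not> mixed 0 C" and C': "\<not> mixed 0 ({1..18} - C)"
    by (auto simp: mixed_compl) (auto simp: mixed_def group_pairs_def pair_def B_def C_def)
  have "\<not> (pair_exchange indep_M)\<^sup>*\<^sup>* (Upair B ({1..18} - B)) (Upair C ({1..18} - C))"
    using pair_exchange_invariant[OF _ B] C C' by fastforce
  moreover have "\<not> (multiset_exchange indep_M)\<^sup>*\<^sup>*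
      (mset [B, {1..18} - B]) (mset [C, {1..18} - C])"
    using multiset_exchange_invariant[OF _ B, of "{#C, {1..18} - C#}"] C C'
    by (auto simp: add_eq_conv_ex)
  moreover have "\<forall>X\<in>set [B, {1..18} - B]. is_basis indep_M X"
      "\<forall>X\<in>set [C, {1..18} - C]. is_basis indep_M X"
    using bases by simp_all
  moreover have "(\<Sum>X\<leftarrow>[B, {1..18} - B]. mset_set X) = (\<Sum>X\<leftarrow>[C, {1..18} - C]. mset_set X)"
    using union by simp
  moreover have "length [B, {1..18} - B] = 2" "length [C, {1..18} - C] = 2" "(1 :: nat) \<le> 2"
    by simp_all
  ultimately show ?thesis
    using bases union by blast
qed

end
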